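(* Let $\Pi_{xy}=\{z=0\}$ and $\Pi_{xy}^+=\{(x,y,z)\in\mathbb{I}^3:z>0\}$. Let $M^2\subset\Pi_{xy}^+$ be the graph of a function $u:\Omega\subset\Pi_{xy}\to\mathbb{R}$, where $\Omega$ is a bounded domain, and let $\Gamma$ and $A_0$ be the boundary curve and the relative area of $M^2$. Then $M^2$ is a critical point of $$\mathcal{E}_{xy}[M^2]=\int_{M^2}z\,\mathrm{d}A^*-\lambda\int_{M^2}\mathrm{d}A^*=\int_{M^2}(z-\lambda)\,\mathrm{d}A^*$$ in the class $\mathcal{C}^{xy}_{\Gamma,A_0}(\Omega)$ if, and only if, its mean curvature $H$ satisfies $$H(\mathbf r)=\frac{\langle\langle\mathbf N_{par},Z\rangle\rangle}{2(z-\lambda)}=\frac{\langle\langle\mathbf N_{par},Z\rangle\rangle}{2\,(d(\mathbf r,\Pi_{xy})-\lambda)},$$ where $Z=\partial_z$.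
   Context: The simply isotropic space $\mathbb{I}^3$ is $\mathbb{R}^3$ with coordinates $(x,y,z)$ and the degenerate metric $\langle\mathbf u,\mathbf v\rangle=u^1v^1+u^2v^2$; the secondary metric is $\langle\langle\mathbf u,\mathbf v\rangle\rangle=u^3v^3$. $\mathcal{C}^{xy}_{\Gamma,A_0}(\Omega)$ is the class of all graphs $G$ over $\Omega$, $G\subset\Pi_{xy}^+$, with boundary $\Gamma$ and relative area $A_0$; $\lambda$ is a Lagrange multiplier due to the constraint on the relative area. The distance from $(x,y,z)$ to $\Pi_{xy}$, measured with the secondary metric, is $d=|z|$, equal to $z$ in $\Pi_{xy}^+$, and $Z=\partial_z=(0,0,1)$. For a graph $\mathbf r(x,y)=(x,y,u(x,y))$: the mean curvature is $H=\frac{u_{xx}+u_{yy}}{2}$; the parabolic normal is $\mathbf N_{par}=\left(-u_x,-u_y,\frac12-\frac{u_x^2+u_y^2}{2}\right)$; the relative area element is $\mathrm{d}A^*=\frac12(1+u_x^2+u_y^2)\,\mathrm{d}x\,\mathrm{d}y$. *)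

theory Defs
  imports "HOL-Analysis.Analysis"
begin

type_synonym plane = "real \<times> real"
type_synonym iso3 = "real \<times> real \<times> real"

section \<open>Simply isotropic space\<close>

fun iso_inner :: "iso3 \<Rightarrow> iso3 \<Rightarrow> real" where
  "iso_inner (u1, u2, u3) (v1, v2, v3) = u1 * v1 + u2 * v2"

fun sec_inner :: "iso3 \<Rightarrow> iso3 \<Rightarrow> real" where
  "sec_inner (u1, u2, u3) (v1, v2, v3) = u3 * v3"

definition sec_setdist :: "iso3 \<Rightarrow> iso3 set \<Rightarrow> real" where
  "sec_setdist r S = (INF q\<in>S. sqrt (sec_inner (r - q) (r - q)))"

definition Pi_xy :: "iso3 set" where
  "Pi_xy = {(x, y, z). z = 0}"

definition Pi_xy_plus :: "iso3 set" where
  "Pi_xy_plus = {(x, y, z). z > 0}"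

definition Zdir :: iso3 where
  "Zdir = (0, 0, 1)"

lemma sec_setdist_Pi_xy: "sec_setdist (x, y, z) Pi_xy = \<bar>z\<bar>"
proof -
  have "(\<lambda>q. sqrt (sec_inner ((x, y, z) - q) ((x, y, z) - q))) ` Pi_xy = {\<bar>z\<bar>}"
    unfolding Pi_xy_def by (auto simp: image_iff)
  then show ?thesis
    by (simp add: sec_setdist_def)
qed

section \<open>Partial derivatives and differentiability classes\<close>

definition Dx :: "(plane \<Rightarrow> real) \<Rightarrow> plane \<Rightarrow> real" where
  "Dx f = (\<lambda>(x, y). deriv (\<lambda>s. f (s, y)) x)"

definition Dy :: "(plane \<Rightarrow> real) \<Rightarrow> plane \<Rightarrow> real" where
  "Dy f = (\<lambda>(x, y). deriv (\<lambda>s. f (x, s)) y)"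

text \<open>Intended for open \<open>S\<close>, where this is the usual class \<open>C\<^sup>k\<close>: total differentiability
  gives the existence of the partial derivatives used in the recursive call.\<close>

fun Ck_on :: "nat \<Rightarrow> (plane \<Rightarrow> real) \<Rightarrow> plane set \<Rightarrow> bool" where
  "Ck_on 0 f S \<longleftrightarrow> continuous_on S f"
| "Ck_on (Suc k) f S \<longleftrightarrow> f differentiable_on S \<and> Ck_on k (Dx f) S \<and> Ck_on k (Dy f) S"

section \<open>Graphs over planar domains\<close>

text \<open>The plane \<open>Pi_xy\<close> is identified with \<open>plane\<close> by dropping the zero coordinate.\<close>

definition graph_param :: "(plane \<Rightarrow> real) \<Rightarrow> plane \<Rightarrow> iso3" where
  "graph_param u = (\<lambda>(x, y). (x, y, u (x, y)))"

definition graph_surface :: "plane set \<Rightarrow> (plane \<Rightarrow> real) \<Rightarrow> iso3 set" where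
  "graph_surface \<Omega> u = graph_param u ` \<Omega>"

text \<open>For \<open>u\<close> continuous on the closure of the bounded open set \<open>\<Omega>\<close>, this is the closure of the
  graph over \<open>\<Omega>\<close> minus that graph.\<close>

definition graph_boundary :: "plane set \<Rightarrow> (plane \<Rightarrow> real) \<Rightarrow> iso3 set" where
  "graph_boundary \<Omega> u = graph_param u ` frontier \<Omega>"

definition mean_curvature :: "(plane \<Rightarrow> real) \<Rightarrow> plane \<Rightarrow> real" where
  "mean_curvature u p = (Dx (Dx u) p + Dy (Dy u) p) / 2"

definition N_par :: "(plane \<Rightarrow> real) \<Rightarrow> plane \<Rightarrow> iso3" where
  "N_par u p = (- Dx u p, - Dy u p, 1 / 2 - ((Dx u p)\<^sup>2 + (Dy u p)\<^sup>2) / 2)"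

definition rel_area_density :: "(plane \<Rightarrow> real) \<Rightarrow> plane \<Rightarrow> real" where
  "rel_area_density u p = (1 + (Dx u p)\<^sup>2 + (Dy u p)\<^sup>2) / 2"

text \<open>The integral of \<open>F\<close> over the graph of \<open>u\<close> with respect to the relative area element.\<close>

definition rel_area_integral :: "plane set \<Rightarrow> (plane \<Rightarrow> real) \<Rightarrow> (iso3 \<Rightarrow> real) \<Rightarrow> real" where
  "rel_area_integral \<Omega> u F = (LINT p:\<Omega>|lborel. F (graph_param u p) * rel_area_density u p)"

definition rel_area :: "plane set \<Rightarrow> (plane \<Rightarrow> real) \<Rightarrow> real" where
  "rel_area \<Omega> u = rel_area_integral \<Omega> u (\<lambda>r. 1)"

definition E_xy :: "real \<Rightarrow> plane set \<Rightarrow> (plane \<Rightarrow> real) \<Rightarrow> real" where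
  "E_xy lam \<Omega> u =
     rel_area_integral \<Omega> u (\<lambda>(x, y, z). z) - lam * rel_area_integral \<Omega> u (\<lambda>r. 1)"

lemma E_xy_eq:
  assumes "set_integrable lborel \<Omega> (rel_area_density u)"
    and "set_integrable lborel \<Omega> (\<lambda>p. u p * rel_area_density u p)"
  shows "E_xy lam \<Omega> u = rel_area_integral \<Omega> u (\<lambda>(x, y, z). z - lam)"
proof -
  have "set_integrable lborel \<Omega> (\<lambda>p. lam * rel_area_density u p)"
    using assms(1) by simp
  from set_integral_diff(2)[OF assms(2) this] show ?thesis
    by (simp add: E_xy_def rel_area_integral_def graph_param_def case_prod_beta algebra_simps)
qed

section \<open>Critical points\<close>

text \<open>A graph is represented by its height function; only the values on the closure of \<open>\<Omega>\<close>
  matter. Integrability makes the relative area finite.\<close>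

definition graph_class :: "plane set \<Rightarrow> iso3 set \<Rightarrow> real \<Rightarrow> (plane \<Rightarrow> real) set" where
  "graph_class \<Omega> \<Gamma> A0 = {u. Ck_on 2 u \<Omega> \<and> continuous_on (closure \<Omega>) u \<and>
     graph_surface \<Omega> u \<subseteq> Pi_xy_plus \<and> graph_boundary \<Omega> u = \<Gamma> \<and>
     set_integrable lborel \<Omega> (rel_area_density u) \<and> rel_area \<Omega> u = A0}"

definition boundary_fixing :: "plane set \<Rightarrow> (plane \<Rightarrow> real) set" where
  "boundary_fixing \<Omega> = {\<phi>. Ck_on 2 \<phi> UNIV \<and>
     compact (closure {p. \<phi> p \<noteq> 0}) \<and> closure {p. \<phi> p \<noteq> 0} \<subseteq> \<Omega>}"

text \<open>Criticality with prescribed Lagrange multiplier \<open>lam\<close>: the multiplier term in \<open>E_xy\<close>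
  accounts for the area constraint, so the first variation is required to vanish in every
  boundary-fixing direction, not just in directions preserving the relative area (for the
  latter \<open>lam\<close> would be irrelevant). For small \<open>t\<close> the graph of \<open>u + t \<phi>\<close> stays in
  \<open>Pi_xy_plus\<close> and has the boundary of the graph of \<open>u\<close>.\<close>

definition critical_in_class ::
  "real \<Rightarrow> plane set \<Rightarrow> iso3 set \<Rightarrow> real \<Rightarrow> (plane \<Rightarrow> real) \<Rightarrow> bool" where
  "critical_in_class lam \<Omega> \<Gamma> A0 u \<longleftrightarrow> u \<in> graph_class \<Omega> \<Gamma> A0 \<and>
     (\<forall>\<phi>\<in>boundary_fixing \<Omega>.
        ((\<lambda>t. E_xy lam \<Omega> (\<lambda>p. u p + t * \<phi> p)) has_real_derivative 0) (at 0))"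

text \<open>The equation \<open>H = \<langle>\<langle>N_par, Z\<rangle>\<rangle> / (2 (z - lam)) = \<langle>\<langle>N_par, Z\<rangle>\<rangle> / (2 (d - lam))\<close> at the
  point over \<open>p\<close>. Division by zero is \<open>0\<close> in HOL, so points of height \<open>lam\<close> need
  separate treatment: there the equation is read with the denominator cleared. Such points
  cannot be excluded: the planar graph \<open>u (x, y) = lam + x\<close> is critical.\<close>

definition curvature_equation :: "real \<Rightarrow> (plane \<Rightarrow> real) \<Rightarrow> plane \<Rightarrow> bool" where
  "curvature_equation lam u p \<longleftrightarrow>
     (u p \<noteq> lam \<longrightarrow>
        mean_curvature u p = sec_inner (N_par u p) Zdir / (2 * (u p - lam)) \<and>
        sec_inner (N_par u p) Zdir / (2 * (u p - lam)) =
          sec_inner (N_par u p) Zdir / (2 * (sec_setdist (graph_param u p) Pi_xy - lam))) \<and>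
     (u p = lam \<longrightarrow> sec_inner (N_par u p) Zdir = 0)"

end

theory Submission
  imports Defs
begin

text \<open>The energy of \<open>u + t \<phi>\<close> is a cubic polynomial in \<open>t\<close> whose linear coefficient is
  \<open>\<integral> \<phi> (1 + |\<nabla>u|\<^sup>2) / 2 + (u - lam) \<nabla>u \<cdot> \<nabla>\<phi>\<close>. Subtracting the divergence of the compactly
  supported field \<open>(u - lam) \<phi> \<nabla>u\<close>, whose integral vanishes by Fubini and the fundamental
  theorem of calculus, turns this into
  \<open>\<integral> \<phi> ((1 - |\<nabla>u|\<^sup>2) / 2 - (u - lam) \<Delta>u)\<close>. Testing against the bumps
  \<open>max 0 (r\<^sup>2 - |p - q|\<^sup>2) ^ 3\<close>, whose exponent is the least integer giving class \<open>C\<^sup>2\<close>, shows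
  that all these integrals vanish exactly when the bracket does.\<close>

section \<open>Calculus of partial derivatives in the plane\<close>

lemma Dx_has_derivative:
  assumes "f differentiable (at (x, y))"
  shows "((\<lambda>s. f (s, y)) has_real_derivative Dx f (x, y)) (at x)"
proof -
  have "(\<lambda>s::real. (s, y)) differentiable (at x)"
    by (auto intro!: derivative_intros)
  then have "(f \<circ> (\<lambda>s. (s, y))) differentiable (at x)"
    using assms by (intro differentiable_chain_at) auto
  then show ?thesis
    by (simp add: Dx_def o_def DERIV_deriv_iff_real_differentiable)
qed

lemma Dy_has_derivative:
  assumes "f differentiable (at (x, y))"
  shows "((\<lambda>s. f (x, s)) has_real_derivative Dy f (x, y)) (at y)"
proof -
  have "(\<lambda>s::real. (x, s)) differentiable (at y)"
    by (auto intro!: derivative_intros)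
  then have "(f \<circ> (\<lambda>s. (x, s))) differentiable (at y)"
    using assms by (intro differentiable_chain_at) auto
  then show ?thesis
    by (simp add: Dy_def o_def DERIV_deriv_iff_real_differentiable)
qed

lemma Dx_eqI: "((\<lambda>s. f (s, y)) has_real_derivative d) (at x) \<Longrightarrow> Dx f (x, y) = d"
  by (simp add: Dx_def DERIV_imp_deriv)

lemma Dy_eqI: "((\<lambda>s. f (x, s)) has_real_derivative d) (at y) \<Longrightarrow> Dy f (x, y) = d"
  by (simp add: Dy_def DERIV_imp_deriv)

text \<open>A partial derivative sees only a line through the point, and such a line meets the open
  set \<open>S\<close> in an open set of parameters; agreement on \<open>S\<close> is therefore
  agreement near the point.\<close>

lemma Dx_cong_open:
  assumes "open S" "p \<in> S" "\<And>q. q \<in> S \<Longrightarrow> f q = g q"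
  shows "Dx f p = Dx g p"
proof -
  obtain x y where p: "p = (x, y)" by force
  have "open ((\<lambda>s. (s, y)) -` S)"
    by (intro open_vimage assms continuous_intros)
  then have "eventually (\<lambda>s. s \<in> (\<lambda>s. (s, y)) -` S) (nhds x)"
    using assms(2) p by (intro eventually_nhds_in_open) auto
  then have "eventually (\<lambda>s. f (s, y) = g (s, y)) (nhds x)"
    by eventually_elim (use assms(3) in auto)
  then show ?thesis
    by (simp add: p Dx_def deriv_cong_ev)
qed

lemma Dy_cong_open:
  assumes "open S" "p \<in> S" "\<And>q. q \<in> S \<Longrightarrow> f q = g q"
  shows "Dy f p = Dy g p"
proof -
  obtain x y where p: "p = (x, y)" by force
  have "open ((\<lambda>s. (x, s)) -` S)"
    by (intro open_vimage assms continuous_intros)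
  then have "eventually (\<lambda>s. s \<in> (\<lambda>s. (x, s)) -` S) (nhds y)"
    using assms(2) p by (intro eventually_nhds_in_open) auto
  then have "eventually (\<lambda>s. f (x, s) = g (x, s)) (nhds y)"
    by eventually_elim (use assms(3) in auto)
  then show ?thesis
    by (simp add: p Dy_def deriv_cong_ev)
qed

lemma Dx_zero: "Dx (\<lambda>p. 0) p = 0"
  by (cases p) (auto intro: Dx_eqI)

lemma Dy_zero: "Dy (\<lambda>p. 0) p = 0"
  by (cases p) (auto intro: Dy_eqI)

lemma Dx_add_scaled:
  assumes "f differentiable (at p)" "g differentiable (at p)"
  shows "Dx (\<lambda>q. f q + t * g q) p = Dx f p + t * Dx g p"
  using assms by (cases p) (auto intro!: Dx_eqI derivative_eq_intros Dx_has_derivative)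

lemma Dy_add_scaled:
  assumes "f differentiable (at p)" "g differentiable (at p)"
  shows "Dy (\<lambda>q. f q + t * g q) p = Dy f p + t * Dy g p"
  using assms by (cases p) (auto intro!: Dy_eqI derivative_eq_intros Dy_has_derivative)

lemma Dx_mult:
  assumes "f differentiable (at p)" "g differentiable (at p)"
  shows "Dx (\<lambda>q. f q * g q) p = Dx f p * g p + f p * Dx g p"
proof (cases p)
  case (Pair x y)
  with DERIV_mult[OF Dx_has_derivative Dx_has_derivative, of f x y g] assms show ?thesis
    by (auto intro: Dx_eqI simp: mult.commute)
qed

lemma Dy_mult:
  assumes "f differentiable (at p)" "g differentiable (at p)"
  shows "Dy (\<lambda>q. f q * g q) p = Dy f p * g p + f p * Dy g p"
proof (cases p)
  case (Pair x y)
  with DERIV_mult[OF Dy_has_derivative Dy_has_derivative, of f x y g] assms show ?thesis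
    by (auto intro: Dy_eqI simp: mult.commute)
qed

text \<open>The constant enters as \<open>- c\<close> times the function 1, whose partial
  derivatives vanish.\<close>

lemma Dx_diff_const: "f differentiable (at p) \<Longrightarrow> Dx (\<lambda>q. f q - c) p = Dx f p"
  using Dx_add_scaled[of f p "\<lambda>_. 1" "- c"] by (cases p) (simp add: Dx_def)

lemma Dy_diff_const: "f differentiable (at p) \<Longrightarrow> Dy (\<lambda>q. f q - c) p = Dy f p"
  using Dy_add_scaled[of f p "\<lambda>_. 1" "- c"] by (cases p) (simp add: Dy_def)

section \<open>Extension by zero and integrals of compactly supported derivatives\<close>

text \<open>The open sets \<open>S\<close> and \<open>- K\<close> cover the space. The extension is
  \<open>f\<close> on the first and zero on the second, so no behaviour of \<open>f\<close> at the
  frontier of \<open>S\<close> enters.\<close>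

lemma continuous_on_extend_zero:
  fixes f :: "'a::topological_space \<Rightarrow> 'b::real_normed_vector"
  assumes "open S" "closed K" "K \<subseteq> S" "continuous_on S f" "\<And>p. p \<in> S - K \<Longrightarrow> f p = 0"
  shows "continuous_on UNIV (\<lambda>p. if p \<in> S then f p else 0)"
proof -
  let ?F = "\<lambda>p. if p \<in> S then f p else 0"
  have "continuous_on S ?F"
    using assms(4) by (rule continuous_on_eq) auto
  moreover have "continuous_on (- K) ?F"
    by (rule continuous_on_eq[of _ "\<lambda>p. 0"]) (use assms(5) in auto)
  ultimately have "continuous_on (S \<union> - K) ?F"
    using assms(1,2) by (intro continuous_on_open_Un) auto
  moreover have "S \<union> - K = UNIV"
    using assms(3) by auto
  ultimately show ?thesis by simp
qed

lemma differentiable_extend_zero: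
  fixes f :: "'a::real_normed_vector \<Rightarrow> 'b::real_normed_vector"
  assumes "open S" "closed K" "K \<subseteq> S" "f differentiable_on S" "\<And>p. p \<in> S - K \<Longrightarrow> f p = 0"
  shows "(\<lambda>p. if p \<in> S then f p else 0) differentiable (at p)"
proof (cases "p \<in> S")
  case True
  then have "f differentiable (at p)"
    using assms(1,4) by (simp add: differentiable_on_eq_differentiable_at)
  then obtain D where "(f has_derivative D) (at p)"
    by (auto simp: differentiable_def)
  then have "((\<lambda>p. if p \<in> S then f p else 0) has_derivative D) (at p)"
    by (rule has_derivative_transform_within_open[OF _ assms(1) True]) auto
  then show ?thesis by (auto simp: differentiable_def)
next
  case False
  have "((\<lambda>p. 0::'b) has_derivative (\<lambda>_. 0)) (at p)" by simp
  then have "((\<lambda>p. if p \<in> S then f p else 0) has_derivative (\<lambda>_. 0)) (at p)"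
    by (rule has_derivative_transform_within_open[of _ _ _ _ "- K"])
      (use assms False in auto)
  then show ?thesis by (auto simp: differentiable_def)
qed

text \<open>Cutting \<open>f\<close> off to \<open>S\<close> or to \<open>K\<close> gives the same
  function, and a continuous function on a compact set is integrable. Nothing is asked of the size
  or regularity of \<open>S\<close>.\<close>

lemma set_integrable_compact_support:
  fixes f :: "'a::euclidean_space \<Rightarrow> real"
  assumes "compact K" "K \<subseteq> S" "continuous_on S f" "\<And>p. p \<in> S - K \<Longrightarrow> f p = 0"
  shows "set_integrable lborel S f"
proof -
  have "integrable lborel (\<lambda>p. indicator K p *\<^sub>R f p)"
    using assms(1) continuous_on_subset[OF assms(3,2)] by (rule borel_integrable_compact)
  moreover have "(\<lambda>p. indicator K p *\<^sub>R f p) = (\<lambda>p. indicator S p *\<^sub>R f p)"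
    using assms(2,4) by (intro ext) (auto simp: indicator_def)
  ultimately show ?thesis
    by (metis set_integrable_def)
qed

text \<open>The whole integral is carried by the interval from \<open>- B\<close> to
  \<open>B\<close>, where the fundamental theorem of calculus gives the difference of two zero
  boundary values.\<close>

lemma integral_DERIV_vanishing_ends:
  fixes g :: "real \<Rightarrow> real"
  assumes "\<And>x. (g has_real_derivative g' x) (at x)" "continuous_on UNIV g'"
    and "- B < B" "\<And>x. \<bar>x\<bar> \<ge> B \<Longrightarrow> g x = 0" "\<And>x. \<bar>x\<bar> > B \<Longrightarrow> g' x = 0"
  shows "(LINT x|lborel. g' x) = 0"
proof -
  have "(LINT x|lborel. g' x * indicator {-B..B} x) = g B - g (-B)"
    using assms by (intro integral_FTC_Icc_real) (auto simp: continuous_on_eq_continuous_at)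
  moreover have "g' x * indicator {-B..B} x = g' x" for x
    using assms(5)[of x] by (cases "\<bar>x\<bar> > B") (auto simp: indicator_def)
  ultimately show ?thesis using assms(3,4) by simp
qed

lemma compact_plane_box:
  fixes K :: "plane set"
  assumes "compact K"
  obtains B where "0 < B" "\<And>x y. (x, y) \<in> K \<Longrightarrow> \<bar>x\<bar> < B \<and> \<bar>y\<bar> < B"
proof -
  obtain B where B: "\<And>p. p \<in> K \<Longrightarrow> norm p < B" "0 < B"
    using compact_imp_bounded[OF assms] bounded_pos_less by metis
  show ?thesis
  proof (rule that[OF B(2)])
    fix x y assume "(x, y) \<in> K"
    then show "\<bar>x\<bar> < B \<and> \<bar>y\<bar> < B"
      using B(1)[of "(x, y)"] norm_fst_le[of x y] norm_snd_le[of y x] by auto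
  qed
qed

text \<open>The horizontal half of the divergence theorem without boundary term. Extension by zero
  removes the domain, so that Fubini can integrate along full horizontal lines, on each of which the
  integral vanishes.\<close>

lemma integral_Dx_compact_support:
  assumes S: "open S" "compact K" "K \<subseteq> S"
    and f: "f differentiable_on S" "continuous_on S (Dx f)" "\<And>p. p \<in> S - K \<Longrightarrow> f p = 0"
  shows "(LINT p:S|lborel. Dx f p) = 0"
proof -
  define g where "g = (\<lambda>p. if p \<in> S then f p else 0)"
  have K: "closed K" using S(2) by (rule compact_imp_closed)
  have dg: "g differentiable (at p)" for p
    unfolding g_def using S(1) K S(3) f(1,3) by (rule differentiable_extend_zero)
  \<comment> \<open>Since \<open>K\<close> is closed, \<open>g\<close> vanishes on a neighbourhood
    of each point outside \<open>K\<close>; this includes the points of the frontier of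
    \<open>S\<close>.\<close>
  have offK: "Dx g p = 0" if "p \<notin> K" for p
  proof -
    have "Dx g p = Dx (\<lambda>_. 0) p"
      by (rule Dx_cong_open[of "- K"]) (use K that f(3) in \<open>auto simp: g_def\<close>)
    then show ?thesis by (simp add: Dx_zero)
  qed
  have onS: "Dx g p = Dx f p" if "p \<in> S" for p
    using Dx_cong_open[OF S(1) that, of g f] by (auto simp: g_def)
  have eq: "Dx g p = indicator S p *\<^sub>R Dx f p" for p
    using offK[of p] onS[of p] S(3) by (auto simp: indicator_def)
  have cont: "continuous_on UNIV (Dx g)"
  proof -
    have "continuous_on UNIV (\<lambda>p. if p \<in> S then Dx f p else 0)"
      by (rule continuous_on_extend_zero[OF S(1) K S(3) f(2)]) (metis DiffE onS offK)
    moreover have "(\<lambda>p. if p \<in> S then Dx f p else 0) = Dx g"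
      by (auto simp: eq)
    ultimately show ?thesis by metis
  qed
  have "set_integrable lborel UNIV (Dx g)"
    by (rule set_integrable_compact_support[OF S(2) _ cont]) (use offK in auto)
  then have int: "integrable (lborel \<Otimes>\<^sub>M lborel) (\<lambda>(x, y). Dx g (x, y))"
    by (simp add: set_integrable_def lborel_prod)
  obtain B where B: "0 < B" "\<And>x y. (x, y) \<in> K \<Longrightarrow> \<bar>x\<bar> < B \<and> \<bar>y\<bar> < B"
    using compact_plane_box[OF S(2)] by metis
  \<comment> \<open>The box bound is strict, so the end points with absolute value exactly
    \<open>B\<close> already lie off \<open>K\<close>, where \<open>g\<close> is zero.\<close>
  have "(LINT x|lborel. Dx g (x, y)) = 0" for y
  proof (rule integral_DERIV_vanishing_ends[where g = "\<lambda>x. g (x, y)" and B = B])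
    show "continuous_on UNIV (\<lambda>x. Dx g (x, y))"
      by (rule continuous_on_compose2[OF cont]) (auto intro!: continuous_intros)
    have *: "(x, y) \<notin> K" if "\<bar>x\<bar> \<ge> B" for x using B(2)[of x y] that by auto
    show "g (x, y) = 0" if "\<bar>x\<bar> \<ge> B" for x
      using *[OF that] f(3) by (auto simp: g_def)
    show "Dx g (x, y) = 0" if "\<bar>x\<bar> > B" for x
      using *[of x] that by (auto intro: offK)
  qed (use B(1) dg in \<open>auto intro: Dx_has_derivative\<close>)
  then have "(LINT p|(lborel \<Otimes>\<^sub>M lborel). Dx g p) = 0"
    using lborel_pair.integral_snd[OF int] by (simp add: case_prod_beta)
  then show ?thesis
    by (simp add: lborel_prod set_lebesgue_integral_def eq)
qed

text \<open>The vertical half: the same argument with the coordinates exchanged, so Fubini now takes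
  the inner integral over \<open>y\<close>.\<close>

lemma integral_Dy_compact_support:
  assumes S: "open S" "compact K" "K \<subseteq> S"
    and f: "f differentiable_on S" "continuous_on S (Dy f)" "\<And>p. p \<in> S - K \<Longrightarrow> f p = 0"
  shows "(LINT p:S|lborel. Dy f p) = 0"
proof -
  define g where "g = (\<lambda>p. if p \<in> S then f p else 0)"
  have K: "closed K" using S(2) by (rule compact_imp_closed)
  have dg: "g differentiable (at p)" for p
    unfolding g_def using S(1) K S(3) f(1,3) by (rule differentiable_extend_zero)
  have offK: "Dy g p = 0" if "p \<notin> K" for p
  proof -
    have "Dy g p = Dy (\<lambda>_. 0) p"
      by (rule Dy_cong_open[of "- K"]) (use K that f(3) in \<open>auto simp: g_def\<close>)
    then show ?thesis by (simp add: Dy_zero)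
  qed
  have onS: "Dy g p = Dy f p" if "p \<in> S" for p
    using Dy_cong_open[OF S(1) that, of g f] by (auto simp: g_def)
  have eq: "Dy g p = indicator S p *\<^sub>R Dy f p" for p
    using offK[of p] onS[of p] S(3) by (auto simp: indicator_def)
  have cont: "continuous_on UNIV (Dy g)"
  proof -
    have "continuous_on UNIV (\<lambda>p. if p \<in> S then Dy f p else 0)"
      by (rule continuous_on_extend_zero[OF S(1) K S(3) f(2)]) (metis DiffE onS offK)
    moreover have "(\<lambda>p. if p \<in> S then Dy f p else 0) = Dy g"
      by (auto simp: eq)
    ultimately show ?thesis by metis
  qed
  have "set_integrable lborel UNIV (Dy g)"
    by (rule set_integrable_compact_support[OF S(2) _ cont]) (use offK in auto)
  then have int: "integrable (lborel \<Otimes>\<^sub>M lborel) (\<lambda>(x, y). Dy g (x, y))"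
    by (simp add: set_integrable_def lborel_prod)
  obtain B where B: "0 < B" "\<And>x y. (x, y) \<in> K \<Longrightarrow> \<bar>x\<bar> < B \<and> \<bar>y\<bar> < B"
    using compact_plane_box[OF S(2)] by metis
  have "(LINT y|lborel. Dy g (x, y)) = 0" for x
  proof (rule integral_DERIV_vanishing_ends[where g = "\<lambda>y. g (x, y)" and B = B])
    show "continuous_on UNIV (\<lambda>y. Dy g (x, y))"
      by (rule continuous_on_compose2[OF cont]) (auto intro!: continuous_intros)
    have *: "(x, y) \<notin> K" if "\<bar>y\<bar> \<ge> B" for y using B(2)[of x y] that by auto
    show "g (x, y) = 0" if "\<bar>y\<bar> \<ge> B" for y
      using *[OF that] f(3) by (auto simp: g_def)
    show "Dy g (x, y) = 0" if "\<bar>y\<bar> > B" for y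
      using *[of y] that by (auto intro: offK)
  qed (use B(1) dg in \<open>auto intro: Dy_has_derivative\<close>)
  then have "(LINT p|(lborel \<Otimes>\<^sub>M lborel). Dy g p) = 0"
    using lborel_pair.integral_fst[OF int] by (simp add: case_prod_beta)
  then show ?thesis
    by (simp add: lborel_prod set_lebesgue_integral_def eq)
qed

section \<open>Truncated powers and bump functions of class C2\<close>

text \<open>Away from 0 the function is locally a power or zero. At 0 an exponent of at least 2 is
  needed: exponent 1 would leave a corner.\<close>

lemma has_real_derivative_max_0_power:
  "((\<lambda>s::real. max 0 s ^ Suc (Suc n)) has_real_derivative
     real (Suc (Suc n)) * max 0 s ^ Suc n) (at s)"
proof (cases s "0::real" rule: linorder_cases)
  case less
  have "((\<lambda>s::real. 0) has_real_derivative 0) (at s)" by simp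
  then have "((\<lambda>s::real. max 0 s ^ Suc (Suc n)) has_real_derivative 0) (at s)"
    by (rule has_field_derivative_transform_within_open[of _ _ _ "{..<0}"]) (use less in auto)
  then show ?thesis using less by simp
next
  case greater
  have "((\<lambda>s::real. s ^ Suc (Suc n)) has_real_derivative real (Suc (Suc n)) * s ^ Suc n) (at s)"
    using DERIV_pow[of "Suc (Suc n)" s UNIV] by simp
  then have "((\<lambda>s::real. max 0 s ^ Suc (Suc n)) has_real_derivative real (Suc (Suc n)) * s ^ Suc n) (at s)"
    by (rule has_field_derivative_transform_within_open[of _ _ _ "{0<..}"]) (use greater in auto)
  then show ?thesis using greater by simp
next
  case equal
  have "((\<lambda>h. max 0 h ^ Suc n) \<longlongrightarrow> max 0 0 ^ Suc n) (at (0::real))"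
    by (intro tendsto_intros)
  \<comment> \<open>For positive \<open>h\<close> one power cancels, for negative \<open>h\<close>
    both sides are zero. Thus the difference quotient is the truncated power of one degree less,
    which tends to 0.\<close>
  moreover have "\<forall>\<^sub>F h in at (0::real). max 0 h ^ Suc n = (max 0 (0 + h) ^ Suc (Suc n) - max 0 0 ^ Suc (Suc n)) / h"
    by (rule eventually_at_filter[THEN iffD2]) (simp add: max_def)
  ultimately have "((\<lambda>h. (max 0 (0 + h) ^ Suc (Suc n) - max 0 0 ^ Suc (Suc n)) / h) \<longlongrightarrow> max 0 0 ^ Suc n) (at (0::real))"
    by (rule Lim_transform_eventually)
  then show ?thesis
    using equal by (simp add: DERIV_def)
qed



lemma differentiable_fst: "fst differentiable F"
  and differentiable_snd: "snd differentiable F"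
  using bounded_linear_fst bounded_linear_snd by (auto intro: bounded_linear_imp_differentiable)

lemma differentiable_max_0_power:
  assumes "w differentiable (at p)"
  shows "(\<lambda>q. max 0 (w q) ^ Suc (Suc n) :: real) differentiable (at p)"
proof -
  have "(\<lambda>s::real. max 0 s ^ Suc (Suc n)) differentiable (at (w p))"
    using has_real_derivative_max_0_power real_differentiable_def by blast
  from differentiable_chain_at[OF assms this] show ?thesis
    by (simp add: o_def)
qed

lemma Dx_max_0_power:
  assumes "P differentiable (at p)" "w differentiable (at p)"
  shows "Dx (\<lambda>q. P q * max 0 (w q) ^ Suc (Suc n)) p =
    Dx P p * max 0 (w p) ^ Suc (Suc n) + P p * (real (Suc (Suc n)) * max 0 (w p) ^ Suc n * Dx w p)"
proof -
  obtain x y where p: "p = (x, y)" by force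
  note d = DERIV_mult[OF Dx_has_derivative DERIV_chain2[OF has_real_derivative_max_0_power Dx_has_derivative]]
  show ?thesis
    unfolding p by (rule Dx_eqI, rule DERIV_cong, rule d) (use assms p in \<open>simp_all add: mult_ac\<close>)
qed

lemma Dy_max_0_power:
  assumes "P differentiable (at p)" "w differentiable (at p)"
  shows "Dy (\<lambda>q. P q * max 0 (w q) ^ Suc (Suc n)) p =
    Dy P p * max 0 (w p) ^ Suc (Suc n) + P p * (real (Suc (Suc n)) * max 0 (w p) ^ Suc n * Dy w p)"
proof -
  obtain x y where p: "p = (x, y)" by force
  note d = DERIV_mult[OF Dy_has_derivative DERIV_chain2[OF has_real_derivative_max_0_power Dy_has_derivative]]
  show ?thesis
    unfolding p by (rule Dy_eqI, rule DERIV_cong, rule d) (use assms p in \<open>simp_all add: mult_ac\<close>)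
qed

lemma Ck_imp_continuous_on: "Ck_on k f S \<Longrightarrow> continuous_on S f"
  by (cases k) (auto intro: differentiable_imp_continuous_on)

text \<open>Differentiation lowers the exponent by one and leaves a continuous truncated power. The
  factor \<open>P\<close> is there because the first derivatives of a bump have this shape, so that
  the criterion applies to them.\<close>

lemma Ck_on_max_0_power:
  assumes "Ck_on 1 P UNIV" "Ck_on 1 w UNIV"
  shows "Ck_on 1 (\<lambda>q. P q * max 0 (w q) ^ Suc (Suc n)) UNIV"
proof -
  have d: "P differentiable (at p)" "w differentiable (at p)" for p
    using assms unfolding One_nat_def Ck_on.simps differentiable_on_def by blast+
  have eq: "Dx (\<lambda>q. P q * max 0 (w q) ^ Suc (Suc n)) =
      (\<lambda>p. Dx P p * max 0 (w p) ^ Suc (Suc n) + P p * (real (Suc (Suc n)) * max 0 (w p) ^ Suc n * Dx w p))"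
    "Dy (\<lambda>q. P q * max 0 (w q) ^ Suc (Suc n)) =
      (\<lambda>p. Dy P p * max 0 (w p) ^ Suc (Suc n) + P p * (real (Suc (Suc n)) * max 0 (w p) ^ Suc n * Dy w p))"
    using Dx_max_0_power[OF d] Dy_max_0_power[OF d] by blast+
  have c: "continuous_on UNIV P" "continuous_on UNIV w" "continuous_on UNIV (Dx P)"
    "continuous_on UNIV (Dy P)" "continuous_on UNIV (Dx w)" "continuous_on UNIV (Dy w)"
    using assms Ck_imp_continuous_on[OF assms(1)] Ck_imp_continuous_on[OF assms(2)] by auto
  have "(\<lambda>q. P q * max 0 (w q) ^ Suc (Suc n)) differentiable_on UNIV"
    unfolding differentiable_on_def
    by (intro ballI differentiable_mult differentiable_max_0_power d)
  then show ?thesis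
    unfolding One_nat_def Ck_on.simps eq using c
    by (intro conjI continuous_intros) auto
qed

text \<open>The squared distance is polynomial in the coordinates, so no singularity arises at the
  centre \<open>q\<close>.\<close>

definition bump :: "plane \<Rightarrow> real \<Rightarrow> plane \<Rightarrow> real" where
  "bump q r p = max 0 (r\<^sup>2 - (dist p q)\<^sup>2) ^ 3"

lemma Ck_on_bump: "Ck_on 2 (bump q r) UNIV"
proof -
  obtain a b where q: "q = (a, b)" by force
  define w where "w = (\<lambda>p::plane. r\<^sup>2 - (fst p - a)\<^sup>2 - (snd p - b)\<^sup>2)"
  \<comment> \<open>The exponent 3 and a trivial factor 1 are displayed in the form required by the
    derivative rules for truncated powers.\<close>
  have bump: "bump q r = (\<lambda>p. 1 * max 0 (w p) ^ Suc (Suc 1))"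
    by (auto simp: bump_def w_def q dist_Pair_Pair dist_real_def numeral_3_eq_3 algebra_simps)
  have dw: "w differentiable (at p)" for p
    unfolding w_def by (intro derivative_intros differentiable_fst differentiable_snd)
  have Dw: "Dx w = (\<lambda>p. - 2 * (fst p - a))" "Dy w = (\<lambda>p. - 2 * (snd p - b))"
    by (auto simp: w_def fun_eq_iff intro!: Dx_eqI Dy_eqI derivative_eq_intros)
  \<comment> \<open>These linear functions serve twice: with \<open>c\<close> equal to
    \<open>-2\<close> as derivatives of \<open>w\<close>, with \<open>c\<close> equal to
    \<open>- 6\<close> as factors in the derivatives of the bump.\<close>
  have lin: "Ck_on 1 (\<lambda>p. c * (fst p - d)) UNIV" "Ck_on 1 (\<lambda>p. c * (snd p - d)) UNIV" for c d
  proof -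
    have "Dx (\<lambda>p. c * (fst p - d)) = (\<lambda>_. c)" "Dy (\<lambda>p. c * (fst p - d)) = (\<lambda>_. 0)"
      "Dx (\<lambda>p. c * (snd p - d)) = (\<lambda>_. 0)" "Dy (\<lambda>p. c * (snd p - d)) = (\<lambda>_. c)"
      by (auto simp: fun_eq_iff intro!: Dx_eqI Dy_eqI derivative_eq_intros)
    then show "Ck_on 1 (\<lambda>p. c * (fst p - d)) UNIV" "Ck_on 1 (\<lambda>p. c * (snd p - d)) UNIV"
      by (auto simp: differentiable_on_def
          intro!: derivative_intros differentiable_fst differentiable_snd)
  qed
  have cw: "Ck_on 1 w UNIV"
    using dw Ck_imp_continuous_on[OF lin(1)[of "-2" a]] Ck_imp_continuous_on[OF lin(2)[of "-2" b]]
    by (simp add: Dw differentiable_on_def)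
  have d1: "(\<lambda>_::plane. 1::real) differentiable (at p)" for p by simp
  \<comment> \<open>The coefficient \<open>- 6\<close> is the exponent 3 times the
    \<open>- 2\<close> from the gradient of \<open>w\<close>. The exponent left is 2, just enough
    for one more continuous derivative.\<close>
  have Dbump: "Dx (bump q r) = (\<lambda>p. (- 6 * (fst p - a)) * max 0 (w p) ^ Suc (Suc 0))"
    "Dy (bump q r) = (\<lambda>p. (- 6 * (snd p - b)) * max 0 (w p) ^ Suc (Suc 0))"
    unfolding bump Dx_max_0_power[OF d1 dw, abs_def] Dy_max_0_power[OF d1 dw, abs_def] Dw
    by (auto simp: fun_eq_iff Dx_def Dy_def)
  have "bump q r differentiable_on UNIV"
    unfolding bump differentiable_on_def
    by (intro ballI differentiable_mult differentiable_max_0_power dw d1)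
  moreover have "Ck_on 1 (Dx (bump q r)) UNIV" "Ck_on 1 (Dy (bump q r)) UNIV"
    unfolding Dbump by (intro Ck_on_max_0_power lin cw)+
  ultimately show ?thesis
    by (simp add: numeral_2_eq_2)
qed

lemma bump_nonneg: "0 \<le> bump q r p"
  by (simp add: bump_def)

lemma bump_eq_0_iff: "0 < r \<Longrightarrow> bump q r p = 0 \<longleftrightarrow> p \<notin> ball q r"
  using power_mono_iff[of r "dist p q" 2] by (auto simp: bump_def max_def dist_commute)

text \<open>The bump is nonzero exactly on the open ball, so its support is the closed ball; this is
  why the closed ball has to fit into \<open>S\<close>.\<close>

lemma bump_boundary_fixing:
  assumes "0 < r" "cball q r \<subseteq> S"
  shows "bump q r \<in> boundary_fixing S"
proof -
  have "{p. bump q r p \<noteq> 0} = ball q r"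
    using bump_eq_0_iff[OF assms(1)] by auto
  then show ?thesis
    using assms Ck_on_bump by (simp add: boundary_fixing_def)
qed

section \<open>The fundamental lemma of the calculus of variations\<close>

text \<open>By continuity \<open>W\<close> is positive on a closed ball around \<open>q\<close>
  inside \<open>S\<close>. Against a bump on that ball the integrand is nonnegative, and positive on
  a set of positive measure.\<close>

lemma fundamental_lemma_positive:
  assumes "open S" "continuous_on S W" "q \<in> S" "W q > 0"
  shows "\<exists>\<phi>\<in>boundary_fixing S. (LINT p:S|lborel. \<phi> p * W p) \<noteq> 0"
proof -
  have "open (S \<inter> W -` {0<..})"
    using assms(1,2) by (intro continuous_open_preimage) auto
  moreover have "q \<in> S \<inter> W -` {0<..}"
    using assms(3,4) by simp
  ultimately obtain r where r: "0 < r" "cball q r \<subseteq> S \<inter> W -` {0<..}"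
    using open_contains_cball by metis
  let ?f = "\<lambda>p. indicator S p *\<^sub>R (bump q r p * W p)"
  have outside: "bump q r p = 0" if "p \<notin> cball q r" for p
    using that r(1) by (simp add: bump_eq_0_iff)
  have int: "integrable lborel ?f"
    unfolding set_integrable_def[symmetric]
  proof (rule set_integrable_compact_support[of "cball q r"])
    show "continuous_on S (\<lambda>p. bump q r p * W p)"
      using continuous_on_subset[OF Ck_imp_continuous_on[OF Ck_on_bump] subset_UNIV] assms(2)
      by (rule continuous_on_mult)
  qed (use r(2) outside in auto)
  have nonneg: "0 \<le> ?f p" for p
  proof (cases "p \<in> cball q r")
    case True
    then have "W p > 0" using r(2) by auto
    then show ?thesis using bump_nonneg[of q r p] by simp
  qed (simp add: outside)
  have "(LINT p|lborel. ?f p) \<noteq> 0"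
  proof
    \<comment> \<open>A nonnegative integrand with zero integral vanishes almost everywhere, which
      would make the nonempty open ball a null set.\<close>
    assume "(LINT p|lborel. ?f p) = 0"
    then have "AE p in lborel. ?f p = 0"
      using integral_nonneg_eq_0_iff_AE[OF int] nonneg by simp
    moreover have "p \<notin> ball q r" if "?f p = 0" for p
    proof
      assume p: "p \<in> ball q r"
      then have "p \<in> cball q r" by auto
      with r(2) have "p \<in> S" "W p > 0" by auto
      then show False
        using that p bump_eq_0_iff[OF r(1), of q p] by simp
    qed
    ultimately have "AE p in lborel. p \<notin> ball q r"
      by (rule eventually_mono)
    then have "ball q r \<in> null_sets lborel"
      using AE_iff_null_sets[of "ball q r" lborel] by simp
    then have "negligible (ball q r)"
      by (simp add: negligible_iff_null_sets null_sets_completionI)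
    then show False
      using open_not_negligible[of "ball q r"] r(1) by simp
  qed
  moreover have "bump q r \<in> boundary_fixing S"
    using r by (intro bump_boundary_fixing) auto
  ultimately show ?thesis
    by (auto simp: set_lebesgue_integral_def)
qed

lemma fundamental_lemma_calculus_of_variations:
  assumes "open S" "continuous_on S W"
    and "\<And>\<phi>. \<phi> \<in> boundary_fixing S \<Longrightarrow> (LINT p:S|lborel. \<phi> p * W p) = 0"
    and "q \<in> S"
  shows "W q = 0"
proof (rule ccontr)
  assume "W q \<noteq> 0"
  then consider "W q > 0" | "- W q > 0" by linarith
  then show False
  proof cases
    case 1
    then show False
      using fundamental_lemma_positive[OF assms(1,2,4)] assms(3) by blast
  next
    case 2
    \<comment> \<open>A negative value of \<open>W\<close> is reduced to the positive case by
      changing the sign.\<close>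
    have "continuous_on S (\<lambda>p. - W p)"
      using assms(2) by (intro continuous_intros)
    from fundamental_lemma_positive[OF assms(1) this assms(4) 2] show False
      using assms(3) by (auto simp: set_lebesgue_integral_def)
  qed
qed


section \<open>The Euler-Lagrange expression and the first variation\<close>

text \<open>The curvature equation with its denominator cleared, both terms on one side. It remains
  meaningful and continuous at points of height \<open>lam\<close>, and it is the density of the
  first variation of \<open>E_xy\<close>.\<close>

definition euler_xy :: "real \<Rightarrow> (plane \<Rightarrow> real) \<Rightarrow> plane \<Rightarrow> real" where
  "euler_xy lam u p = sec_inner (N_par u p) Zdir - 2 * (u p - lam) * mean_curvature u p"

lemma euler_xy_alt:
  "euler_xy lam u p =
    (1 - (Dx u p)\<^sup>2 - (Dy u p)\<^sup>2) / 2 - (u p - lam) * (Dx (Dx u) p + Dy (Dy u) p)"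
  by (simp add: euler_xy_def N_par_def Zdir_def mean_curvature_def field_simps)

lemma continuous_on_euler_xy:
  assumes "Ck_on 2 u S"
  shows "continuous_on S (euler_xy lam u)"
  unfolding euler_xy_alt[abs_def]
  using assms
  by (intro continuous_intros) (auto simp: numeral_2_eq_2 dest: differentiable_imp_continuous_on)

text \<open>Positive height identifies the distance to \<open>Pi_xy\<close> with \<open>u p\<close>,
  so the second equality becomes trivial. Off height \<open>lam\<close> one divides by a nonzero
  factor; at height \<open>lam\<close> the curvature term drops out, leaving the separate
  clause.\<close>

lemma curvature_equation_iff:
  assumes "0 < u p"
  shows "curvature_equation lam u p \<longleftrightarrow> euler_xy lam u p = 0"
proof -
  have "sec_setdist (graph_param u p) Pi_xy = u p"
    using assms by (cases p) (simp add: graph_param_def sec_setdist_Pi_xy)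
  then show ?thesis
    by (auto simp: curvature_equation_def euler_xy_def field_simps)
qed

text \<open>Boundedness of \<open>S\<close> and continuity of \<open>u\<close> on the closure make
  the energy of \<open>u\<close> itself integrable. All other terms contain \<phi> or its
  derivatives, so compact support makes them integrable and removes boundary terms.\<close>

lemma first_variation_E_xy:
  assumes S: "open S" "bounded S"
    and u: "Ck_on 2 u S" "continuous_on (closure S) u" "set_integrable lborel S (rel_area_density u)"
    and \<phi>: "\<phi> \<in> boundary_fixing S"
  shows "((\<lambda>t. E_xy lam S (\<lambda>p. u p + t * \<phi> p)) has_real_derivative
    (LINT p:S|lborel. \<phi> p * euler_xy lam u p)) (at 0)"
proof -
  define K where "K = closure {p. \<phi> p \<noteq> 0}"
  have K: "compact K" "K \<subseteq> S" "closed K" and \<phi>2: "Ck_on 2 \<phi> UNIV"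
    using \<phi> by (auto simp: K_def boundary_fixing_def)
  have \<phi>0: "\<phi> p = 0" if "p \<notin> K" for p
    using that closure_subset[of "{p. \<phi> p \<noteq> 0}"] by (auto simp: K_def)
  have \<phi>x0: "Dx \<phi> p = 0" if "p \<notin> K" for p
  proof -
    have "Dx \<phi> p = Dx (\<lambda>_. 0) p"
      by (rule Dx_cong_open[of "- K"]) (use K(3) that \<phi>0 in auto)
    then show ?thesis by (simp add: Dx_zero)
  qed
  have \<phi>y0: "Dy \<phi> p = 0" if "p \<notin> K" for p
  proof -
    have "Dy \<phi> p = Dy (\<lambda>_. 0) p"
      by (rule Dy_cong_open[of "- K"]) (use K(3) that \<phi>0 in auto)
    then show ?thesis by (simp add: Dy_zero)
  qed
  have d_on: "u differentiable_on S" "Dx u differentiable_on S" "Dy u differentiable_on S"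
    "\<phi> differentiable_on S"
    using u(1) \<phi>2 by (auto simp: numeral_2_eq_2 intro: differentiable_on_subset)
  have d: "u differentiable (at p)" "Dx u differentiable (at p)" "Dy u differentiable (at p)"
    "\<phi> differentiable (at p)" if "p \<in> S" for p
    using d_on that S(1) by (simp_all add: differentiable_on_eq_differentiable_at)
  have c: "continuous_on S u" "continuous_on S (Dx u)" "continuous_on S (Dy u)"
    "continuous_on S (Dx (Dx u))" "continuous_on S (Dy (Dy u))" "continuous_on S \<phi>"
    using d_on u(1) by (simp_all add: numeral_2_eq_2 differentiable_imp_continuous_on)
  have "Dx \<phi> differentiable_on UNIV" "Dy \<phi> differentiable_on UNIV"
    using \<phi>2 by (simp_all add: numeral_2_eq_2)
  then have c\<phi>: "continuous_on S (Dx \<phi>)" "continuous_on S (Dy \<phi>)"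
    by (auto dest!: differentiable_imp_continuous_on intro: continuous_on_subset)
  note c = c c\<phi>
  let ?\<rho> = "rel_area_density u"
  \<comment> \<open>\<open>B\<close> and \<open>C\<close> are the coefficients of \<open>t\<close>
    and \<open>t\<^sup>2\<close> in the area density of the graph of \<open>u + t * \<phi>\<close>;
    \<open>?\<rho>\<close> is the constant term.\<close>
  define B where "B = (\<lambda>p. Dx u p * Dx \<phi> p + Dy u p * Dy \<phi> p)"
  define C where "C = (\<lambda>p. ((Dx \<phi> p)\<^sup>2 + (Dy \<phi> p)\<^sup>2) / 2)"
  have c\<rho>: "continuous_on S ?\<rho>"
    unfolding rel_area_density_def[abs_def] using c by (intro continuous_intros) auto
  have cBC: "continuous_on S B" "continuous_on S C"
    unfolding B_def C_def using c by (intro continuous_intros; simp)+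
  note c = c c\<rho> cBC
  have BC0: "B p = 0" "C p = 0" if "p \<notin> K" for p
    using \<phi>x0[OF that] \<phi>y0[OF that] by (simp_all add: B_def C_def)
  have supp: "set_integrable lborel S f"
    if "continuous_on S f" "\<And>p. p \<notin> K \<Longrightarrow> f p = 0" for f :: "plane \<Rightarrow> real"
    using set_integrable_compact_support[OF K(1,2) that(1)] that(2) by simp
  have dens: "rel_area_density (\<lambda>q. u q + t * \<phi> q) p = ?\<rho> p + t * B p + t\<^sup>2 * C p"
    if "p \<in> S" for t p
    using d(1,4)[OF that]
    by (simp add: rel_area_density_def Dx_add_scaled Dy_add_scaled B_def C_def)
      (simp add: power2_eq_square field_simps)

  \<comment> \<open>The density may be unbounded near the frontier, so the product is dominated by a
    constant multiple of it: \<open>u\<close> is bounded by some \<open>m\<close> on the compact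
    closure.\<close>
  have i\<rho>: "set_integrable lborel S (\<lambda>p. u p * ?\<rho> p)"
  proof -
    have "compact (u ` closure S)"
      using S(2) u(2) by (intro compact_continuous_image) auto
    then obtain m where m: "\<And>p. p \<in> closure S \<Longrightarrow> norm (u p) \<le> m"
      using compact_imp_bounded bounded_iff by (metis imageI)
    show ?thesis
    proof (rule set_integrable_bound)
      show "set_integrable lborel S (\<lambda>p. m * ?\<rho> p)"
        using u(3) by simp
      show "set_borel_measurable lborel S (\<lambda>p. u p * ?\<rho> p)"
        unfolding set_borel_measurable_def
        using borel_measurable_continuous_on_indicator[of S "\<lambda>p. u p * ?\<rho> p"] S(1) c
        by (auto intro!: continuous_on_mult)
      have "norm (u p * ?\<rho> p) \<le> norm (m * ?\<rho> p)" if "p \<in> S" for p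
      proof -
        have "\<bar>u p\<bar> \<le> m" using m[of p] closure_subset[of S] that by auto
        then show ?thesis by (simp add: abs_mult mult_right_mono)
      qed
      then show "AE p in lborel. p \<in> S \<longrightarrow> norm (u p * ?\<rho> p) \<le> norm (m * ?\<rho> p)"
        by simp
    qed
  qed
  \<comment> \<open>The coefficients of \<open>t\<close>, \<open>t\<^sup>2\<close> and
    \<open>t ^ 3\<close> in the product of \<open>u + t * \<phi>\<close> with
    \<open>?\<rho> + t * B + t\<^sup>2 * C\<close>.\<close>
  define f1 where "f1 = (\<lambda>p. \<phi> p * ?\<rho> p + u p * B p)"
  define f2 where "f2 = (\<lambda>p. \<phi> p * B p + u p * C p)"
  define f3 where "f3 = (\<lambda>p. \<phi> p * C p)"
  have int: "set_integrable lborel S f1" "set_integrable lborel S f2" "set_integrable lborel S f3"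
    "set_integrable lborel S B" "set_integrable lborel S C"
    unfolding f1_def f2_def f3_def
    by (rule supp; use c BC0 \<phi>0 in \<open>auto intro!: continuous_on_add continuous_on_mult\<close>)+
  have cubic: "E_xy lam S (\<lambda>p. u p + t * \<phi> p) =
    ((LINT p:S|lborel. u p * ?\<rho> p) - lam * (LINT p:S|lborel. ?\<rho> p)) +
    t * ((LINT p:S|lborel. f1 p) - lam * (LINT p:S|lborel. B p)) +
    t\<^sup>2 * ((LINT p:S|lborel. f2 p) - lam * (LINT p:S|lborel. C p)) +
    t ^ 3 * (LINT p:S|lborel. f3 p)" for t
  proof -
    have "rel_area_integral S (\<lambda>p. u p + t * \<phi> p) (\<lambda>(x, y, z). z) =
      (LINT p:S|lborel. u p * ?\<rho> p + t * f1 p + t\<^sup>2 * f2 p + t ^ 3 * f3 p)"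
      unfolding rel_area_integral_def
      by (rule set_lebesgue_integral_cong)
        (use S(1) in \<open>auto simp: dens graph_param_def f1_def f2_def f3_def algebra_simps
            power2_eq_square power3_eq_cube\<close>)
    also have "\<dots> = (LINT p:S|lborel. u p * ?\<rho> p) + t * (LINT p:S|lborel. f1 p) +
      t\<^sup>2 * (LINT p:S|lborel. f2 p) + t ^ 3 * (LINT p:S|lborel. f3 p)"
      using int i\<rho> by simp
    finally have z: "rel_area_integral S (\<lambda>p. u p + t * \<phi> p) (\<lambda>(x, y, z). z) = \<dots>" .
    have "rel_area_integral S (\<lambda>p. u p + t * \<phi> p) (\<lambda>r. 1) =
      (LINT p:S|lborel. ?\<rho> p + t * B p + t\<^sup>2 * C p)"
      unfolding rel_area_integral_def
      by (rule set_lebesgue_integral_cong) (use S(1) in \<open>auto simp: dens\<close>)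
    also have "\<dots> = (LINT p:S|lborel. ?\<rho> p) + t * (LINT p:S|lborel. B p) +
      t\<^sup>2 * (LINT p:S|lborel. C p)"
      using int u(3) by simp
    finally show ?thesis
      unfolding E_xy_def z by (simp add: algebra_simps)
  qed

  \<comment> \<open>The factor of the gradient of \<open>u\<close> in the subtracted field. The
    field inherits the compact support of \<phi>, and its divergence needs only second derivatives
    of \<open>u\<close> and first derivatives of \<phi>.\<close>
  define h where "h = (\<lambda>p. (u p - lam) * \<phi> p)"
  have dh: "(\<lambda>p. h p * Dx u p) differentiable_on S" "(\<lambda>p. h p * Dy u p) differentiable_on S"
    unfolding h_def using d_on by (auto intro!: derivative_intros)
  have Dh: "Dx (\<lambda>p. h p * Dx u p) p =
      Dx u p * \<phi> p * Dx u p + (u p - lam) * Dx \<phi> p * Dx u p + h p * Dx (Dx u) p"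
    "Dy (\<lambda>p. h p * Dy u p) p =
      Dy u p * \<phi> p * Dy u p + (u p - lam) * Dy \<phi> p * Dy u p + h p * Dy (Dy u) p"
    if p: "p \<in> S" for p
    using d[OF p] unfolding h_def
    by (simp_all add: Dx_mult Dy_mult Dx_diff_const Dy_diff_const distrib_right)
  have "continuous_on S h"
    unfolding h_def by (intro continuous_intros c)
  note c = c this
  have cDh: "continuous_on S (Dx (\<lambda>p. h p * Dx u p))" "continuous_on S (Dy (\<lambda>p. h p * Dy u p))"
    by (subst continuous_on_cong[OF refl Dh(1)] continuous_on_cong[OF refl Dh(2)], assumption,
        intro continuous_intros c)+
  have zero: "(LINT p:S|lborel. Dx (\<lambda>p. h p * Dx u p) p) = 0"
    "(LINT p:S|lborel. Dy (\<lambda>p. h p * Dy u p) p) = 0"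
    using integral_Dx_compact_support[OF S(1) K(1,2) dh(1) cDh(1)]
      integral_Dy_compact_support[OF S(1) K(1,2) dh(2) cDh(2)] \<phi>0
    by (simp_all add: h_def)
  have iDh: "set_integrable lborel S (Dx (\<lambda>p. h p * Dx u p))"
    "set_integrable lborel S (Dy (\<lambda>p. h p * Dy u p))"
  proof -
    have "Dx (\<lambda>p. h p * Dx u p) p = 0" "Dy (\<lambda>p. h p * Dy u p) p = 0" if "p \<in> S - K" for p
      using that Dh[of p] \<phi>0[of p] \<phi>x0[of p] \<phi>y0[of p] by (simp_all add: h_def)
    with cDh show "set_integrable lborel S (Dx (\<lambda>p. h p * Dx u p))"
      "set_integrable lborel S (Dy (\<lambda>p. h p * Dy u p))"
      by (blast intro: set_integrable_compact_support[OF K(1,2)])+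
  qed
  have ie: "set_integrable lborel S (\<lambda>p. \<phi> p * euler_xy lam u p)"
    using c(6) continuous_on_euler_xy[OF u(1)] \<phi>0 by (intro supp continuous_on_mult) auto
  have "(LINT p:S|lborel. f1 p) - lam * (LINT p:S|lborel. B p) =
    (LINT p:S|lborel. f1 p + (- lam) * B p)"
    using int by simp
  \<comment> \<open>A pointwise identity: the divergence absorbs \<open>(u - lam) * B\<close>, and
    its term with the squared gradient of \<open>u\<close> turns \<open>(1 + ...) / 2\<close> into
    \<open>(1 - ...) / 2\<close>, while the Laplacian terms cancel.\<close>
  also have "\<dots> = (LINT p:S|lborel. Dx (\<lambda>p. h p * Dx u p) p + Dy (\<lambda>p. h p * Dy u p) p
      + \<phi> p * euler_xy lam u p)"
    by (rule set_lebesgue_integral_cong)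
      (use S(1) in \<open>simp_all add: Dh,
        simp_all add: f1_def B_def h_def euler_xy_alt rel_area_density_def
          field_simps power2_eq_square\<close>)
  also have "\<dots> = (LINT p:S|lborel. \<phi> p * euler_xy lam u p)"
    using iDh ie zero by simp
  finally have b: "(LINT p:S|lborel. f1 p) - lam * (LINT p:S|lborel. B p) = \<dots>" .
  show ?thesis
    unfolding cubic b by (auto intro!: derivative_eq_intros)
qed

theorem theorem8:
  fixes \<Omega> :: "plane set" and u :: "plane \<Rightarrow> real"
    and M \<Gamma> :: "iso3 set" and A0 lam :: real
  assumes "open \<Omega>" and "connected \<Omega>" and "\<Omega> \<noteq> {}" and "bounded \<Omega>"
    and "Ck_on 2 u \<Omega>" and "continuous_on (closure \<Omega>) u"
    and "M = graph_surface \<Omega> u" and "M \<subseteq> Pi_xy_plus"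
    and "\<Gamma> = graph_boundary \<Omega> u"
    and "set_integrable lborel \<Omega> (rel_area_density u)"
    and "A0 = rel_area \<Omega> u"
  shows "critical_in_class lam \<Omega> \<Gamma> A0 u \<longleftrightarrow> (\<forall>p\<in>\<Omega>. curvature_equation lam u p)"
proof -
  note var = first_variation_E_xy[OF assms(1,4,5,6,10)]
  \<comment> \<open>The derivative at 0 always exists and equals the integral, so by uniqueness it
    is 0 exactly when the integral is.\<close>
  have "((\<lambda>t. E_xy lam \<Omega> (\<lambda>p. u p + t * \<phi> p)) has_real_derivative 0) (at 0) \<longleftrightarrow>
    (LINT p:\<Omega>|lborel. \<phi> p * euler_xy lam u p) = 0" if "\<phi> \<in> boundary_fixing \<Omega>" for \<phi>
    using var[OF that, of lam] by (auto dest: DERIV_unique)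
  \<comment> \<open>Membership is automatic, as \<Gamma> and \<open>A0\<close> are the boundary and
    relative area of this very graph; only the variational condition remains.\<close>
  moreover have "u \<in> graph_class \<Omega> \<Gamma> A0"
    using assms by (simp add: graph_class_def)
  ultimately have "critical_in_class lam \<Omega> \<Gamma> A0 u \<longleftrightarrow>
    (\<forall>\<phi>\<in>boundary_fixing \<Omega>. (LINT p:\<Omega>|lborel. \<phi> p * euler_xy lam u p) = 0)"
    by (simp add: critical_in_class_def)
  also have "\<dots> \<longleftrightarrow> (\<forall>p\<in>\<Omega>. euler_xy lam u p = 0)"
  proof
    assume "\<forall>\<phi>\<in>boundary_fixing \<Omega>. (LINT p:\<Omega>|lborel. \<phi> p * euler_xy lam u p) = 0"
    then show "\<forall>p\<in>\<Omega>. euler_xy lam u p = 0"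
      using fundamental_lemma_calculus_of_variations[OF assms(1) continuous_on_euler_xy[OF assms(5)]]
      by blast
  next
    assume 0: "\<forall>p\<in>\<Omega>. euler_xy lam u p = 0"
    have "(LINT p:\<Omega>|lborel. \<phi> p * euler_xy lam u p) = (LINT p:\<Omega>|lborel. 0)" for \<phi>
      by (rule set_lebesgue_integral_cong) (use assms(1) 0 in auto)
    then show "\<forall>\<phi>\<in>boundary_fixing \<Omega>. (LINT p:\<Omega>|lborel. \<phi> p * euler_xy lam u p) = 0"
      by simp
  qed
  also have "\<dots> \<longleftrightarrow> (\<forall>p\<in>\<Omega>. curvature_equation lam u p)"
  proof -
    have "0 < u p" if "p \<in> \<Omega>" for p
      using assms(7,8) that
      by (cases p) (force simp: graph_surface_def graph_param_def Pi_xy_plus_def)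
    then show ?thesis by (simp add: curvature_equation_iff)
  qed
  finally show ?thesis .
qed

end
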